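(* Let $M,N\ge 1$ be integers, let $\mathbf h\in\mathbb C^{M}$, $\mathbf f,\mathbf g\in\mathbb C^{N}$ be nonzero vectors, let $P_s,\sigma_r^2,\sigma_d^2>0$ and $0<\eta\le 1$. Put $A= P_s\|\mathbf h\|^2+\sigma_r^2$, $\gamma_1= P_s\|\mathbf h\|^2/\sigma_r^2$, and let $\theta\in[0,\pi/2]$ be defined by $\cos\theta=|\mathbf f^H\mathbf g|/(\|\mathbf f\|\,\|\mathbf g\|)$. Consider the optimization problem (P1) over $P_r\in\mathbb R$ and $\mathbf v_r\in\mathbb C^{N}$: $$\max_{P_r,\mathbf v_r}\ \gamma_2:=\frac{P_r|\mathbf g^H\mathbf v_r|^2}{\sigma_d^2}\quad\text{s.t.}\quad 0\le P_r\le \eta P_s\|\mathbf h\|^2\Big(1+\frac{\sqrt{P_r}}{\sqrt A}|\mathbf f^H\mathbf v_r|\Big)^2,\quad \|\mathbf v_r\|=1.$$ The optimal solution $(P_r^\star,\mathbf v_r^\star)$ to (P1) is $$P_r^\star=\|\mathbf v^\star\|^2,\qquad \mathbf v_r^\star=\mathbf v^\star/\|\mathbf v^\star\|,\qquad\text{where}\quad \mathbf v^\star=\alpha_1 e^{j\angle \mathbf g^H\mathbf f}\,\mathbf g+\alpha_2\,\mathbf f,$$ with $$\alpha_1=\frac{\|\mathbf h\|\sqrt{\left(1+\frac1{\gamma_1}\right)\eta P_s}}{\|\mathbf g\|\sqrt{1+\frac1{\gamma_1}-\eta\|\mathbf f\|^2\sin^2\theta}},\qquad \alpha_2=\frac{\eta\|\mathbf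 h\|\sqrt{\left(1+\frac1{\gamma_1}\right)P_s}}{1+\frac1{\gamma_1}-\eta\|\mathbf f\|^2}\left(1+\frac{\sqrt\eta\,\|\mathbf f\|\cos\theta}{\sqrt{1+\frac1{\gamma_1}-\eta\|\mathbf f\|^2\sin^2\theta}}\right).$$ The corresponding optimal value of (P1) is $$\gamma_2^\star=\frac{\left(1+\frac1{\gamma_1}\right)\eta P_s\|\mathbf h\|^2\|\mathbf g\|^2}{\sigma_d^2\left(1+\frac1{\gamma_1}-\eta\|\mathbf f\|^2\right)^2}\left(\sqrt\eta\,\|\mathbf f\|\cos\theta+\sqrt{1+\frac1{\gamma_1}-\eta\|\mathbf f\|^2\sin^2\theta}\right)^2,$$ and the maximum end-to-end throughput from the source to the destination (the maximum of the quantity $R$ defined in the context over the feasible $(P_r,\mathbf v_r)$ of (P1)) is $$R^\star=\frac12\log_2\left(1+\frac{\gamma_1\gamma_2^\star}{\gamma_1+\gamma_2^\star+1}\right).$$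
   Context: $\|\cdot\|$ is the Euclidean norm, $(\cdot)^H$ is the conjugate transpose, $j=\sqrt{-1}$, and $\angle z$ is the phase of the complex number $z$. The setting is a full-duplex wireless-powered amplify-and-forward relay: $\mathbf h$ is the source-to-relay channel, $\mathbf g$ the relay-to-destination channel, $\mathbf f$ the loop channel from the relay's transmitting antennas to its receiving antenna, $P_s$ the source power, $P_r$ the relay power, $\mathbf v_r$ the relay beamforming vector, $\sigma_r^2,\sigma_d^2$ the noise powers at relay and destination, and $\eta$ the energy harvesting efficiency. The constraint on $P_r$ says that the energy used by the relay does not exceed the energy it harvests. The end-to-end throughput is $R=\frac12\log_2(1+\gamma_d)$, where $$\gamma_d=\frac{P_s\|\mathbf h\|^2}{\sigma_r^2+\frac{\sigma_d^2A}{P_r|\mathbf g^H\mathbf v_r|^2}}$$ is the received signal-to-noise ratio at the destination.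
   Formalization: The formal theorem adds the condition η‖f‖² < 1 + 1/γ₁, without which γ₂ is unbounded over the feasible set and no optimum exists; "the optimal solution" is read as "a maximizer", since v_r is only determined up to a unit phase. *)

theory Defs
  imports "HOL-Analysis.Analysis"
begin

definition herm_prod :: "complex ^ 'n \<Rightarrow> complex ^ 'n \<Rightarrow> complex"
  where "herm_prod x y = (\<Sum>i\<in>UNIV. cnj (x $ i) * y $ i)"

text \<open>
  A decision variable is a pair of the relay power and the relay beamforming vector.
  Noise powers are passed as such: \<open>sr2\<close> and \<open>sd2\<close> stand for \<open>\<sigma>\<^sub>r\<^sup>2\<close> and \<open>\<sigma>\<^sub>d\<^sup>2\<close>.
\<close>

definition recv_power :: "real \<Rightarrow> real \<Rightarrow> complex ^ 'm \<Rightarrow> real"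
  where "recv_power Ps sr2 h = Ps * (norm h)\<^sup>2 + sr2"

definition P1_feasible ::
  "real \<Rightarrow> real \<Rightarrow> real \<Rightarrow> complex ^ 'm \<Rightarrow> complex ^ 'n \<Rightarrow> real \<times> (complex ^ 'n) \<Rightarrow> bool"
  where "P1_feasible Ps sr2 \<eta> h f = (\<lambda>(Pr, vr).
    0 \<le> Pr \<and>
    Pr \<le> \<eta> * Ps * (norm h)\<^sup>2 *
      (1 + sqrt Pr / sqrt (recv_power Ps sr2 h) * cmod (herm_prod f vr))\<^sup>2 \<and>
    norm vr = 1)"

definition gamma2 :: "real \<Rightarrow> complex ^ 'n \<Rightarrow> real \<times> (complex ^ 'n) \<Rightarrow> real"
  where "gamma2 sd2 g = (\<lambda>(Pr, vr). Pr * (cmod (herm_prod g vr))\<^sup>2 / sd2)"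

text \<open>
  If no signal is forwarded, i.e. \<open>Pr * |g\<^sup>H vr|\<^sup>2 = 0\<close>, the noise term in the denominator of the
  destination SNR is infinite and the SNR is \<open>0\<close>. This case is separated because division
  by zero yields \<open>0\<close> in HOL, which would turn that noise term into \<open>0\<close> instead.
\<close>

definition gamma_d ::
  "real \<Rightarrow> real \<Rightarrow> real \<Rightarrow> complex ^ 'm \<Rightarrow> complex ^ 'n \<Rightarrow> real \<times> (complex ^ 'n) \<Rightarrow> real"
  where "gamma_d Ps sr2 sd2 h g = (\<lambda>(Pr, vr).
    if Pr * (cmod (herm_prod g vr))\<^sup>2 = 0 then 0
    else Ps * (norm h)\<^sup>2 /
      (sr2 + sd2 * recv_power Ps sr2 h / (Pr * (cmod (herm_prod g vr))\<^sup>2)))"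

definition throughput ::
  "real \<Rightarrow> real \<Rightarrow> real \<Rightarrow> complex ^ 'm \<Rightarrow> complex ^ 'n \<Rightarrow> real \<times> (complex ^ 'n) \<Rightarrow> real"
  where "throughput Ps sr2 sd2 h g x = 1 / 2 * log 2 (1 + gamma_d Ps sr2 sd2 h g x)"

end

theory Submission
  imports Defs
begin

text \<open>
  In terms of \<open>v = sqrt Pr *\<^sub>R vr\<close>, the power constraint reads \<open>norm v \<le> B + k * |f\<^sup>H v|\<close> with
  \<open>B = norm h * sqrt (\<eta> * Ps)\<close> and \<open>k = sqrt (\<eta> / (1 + 1 / \<gamma>1))\<close>, and the objective is
  \<open>|g\<^sup>H v|\<^sup>2 / sd2\<close>. Put \<open>d = sqrt (1 - k\<^sup>2 * (norm f)\<^sup>2 * (sin \<theta>)\<^sup>2)\<close> and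
  \<open>e = d - k * norm f * cos \<theta>\<close>. For all phases \<open>p\<close>, \<open>q\<close> the vector
  \<open>(e / norm g) * cis p * g + k * cis q * f\<close> has norm at most \<open>1\<close>, so Cauchy--Schwarz gives
  \<open>e / norm g * |g\<^sup>H v| + k * |f\<^sup>H v| \<le> norm v\<close>. Hence \<open>|g\<^sup>H v| \<le> B * norm g / e\<close> for feasible
  \<open>v\<close>, with equality when \<open>v\<close> is proportional to that vector with aligned phases, scaled so that
  the constraint is tight. The throughput is an increasing function of \<open>\<gamma>2\<close>.
\<close>

section \<open>Hermitian product, norms and phase alignment\<close>

lemma herm_prod_add_left: "herm_prod (x + y) z = herm_prod x z + herm_prod y z"
  by (simp add: herm_prod_def sum.distrib algebra_simps)

lemma herm_prod_add_right: "herm_prod z (x + y) = herm_prod z x + herm_prod z y"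
  by (simp add: herm_prod_def sum.distrib algebra_simps)

lemma herm_prod_scale_left: "herm_prod (a *s x) y = cnj a * herm_prod x y"
  by (simp add: herm_prod_def sum_distrib_left algebra_simps)

lemma herm_prod_scale_right: "herm_prod x (a *s y) = a * herm_prod x y"
  by (simp add: herm_prod_def sum_distrib_left algebra_simps)

lemma herm_prod_scaleR_right: "herm_prod x (r *\<^sub>R y) = of_real r * herm_prod x y"
  by (simp add: herm_prod_def sum_distrib_left) (simp add: scaleR_conv_of_real mult_ac)

lemma cnj_herm_prod: "cnj (herm_prod x y) = herm_prod y x"
  by (simp add: herm_prod_def mult.commute)

lemma cmod_herm_prod_commute: "cmod (herm_prod x y) = cmod (herm_prod y x)"
  by (metis cnj_herm_prod complex_mod_cnj)

lemma cnj_mult_self: "cnj z * z = of_real ((cmod z)\<^sup>2)"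
  by (simp only: complex_norm_square mult.commute)

lemma herm_prod_self: "herm_prod x x = of_real ((norm x)\<^sup>2)"
proof -
  have "(norm x)\<^sup>2 = (\<Sum>i\<in>UNIV. (cmod (x $ i))\<^sup>2)"
    by (simp add: norm_vec_def L2_set_def sum_nonneg)
  then show ?thesis
    by (simp add: herm_prod_def cnj_mult_self)
qed

text \<open>The triangle inequality reduces this to the real Cauchy--Schwarz inequality for the
  moduli of the entries.\<close>

lemma cmod_herm_prod_le: "cmod (herm_prod x y) \<le> norm x * norm y"
proof -
  have "cmod (herm_prod x y) \<le> (\<Sum>i\<in>UNIV. \<bar>cmod (x $ i)\<bar> * \<bar>cmod (y $ i)\<bar>)"
    unfolding herm_prod_def by (rule order.trans[OF norm_sum]) (simp add: norm_mult)
  also have "\<dots> \<le> norm x * norm y"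
    unfolding norm_vec_def by (rule L2_set_mult_ineq)
  finally show ?thesis .
qed

text \<open>Used to align phases: rotating a number back by its own argument leaves its
  modulus.\<close>

lemma cnj_cis_Arg_mult: "cnj (cis (Arg z)) * z = of_real (cmod z)"
proof -
  have "z = of_real (cmod z) * cis (Arg z)"
    using rcis_cmod_Arg[of z] by (simp add: rcis_def)
  then have "cnj (cis (Arg z)) * z = of_real (cmod z) * (cnj (cis (Arg z)) * cis (Arg z))"
    by (metis mult.left_commute)
  then show ?thesis by (simp only: cnj_mult_self norm_cis) simp
qed

lemma norm_lincomb_squared:
  "(norm (a *s x + b *s y))\<^sup>2 =
    (cmod a)\<^sup>2 * (norm x)\<^sup>2 + (cmod b)\<^sup>2 * (norm y)\<^sup>2 + 2 * Re (cnj a * b * herm_prod x y)"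
proof -
  have "herm_prod (a *s x + b *s y) (a *s x + b *s y) =
      cnj a * a * herm_prod x x + cnj b * b * herm_prod y y
      + (cnj a * b * herm_prod x y + cnj (cnj a * b * herm_prod x y))"
    by (simp add: herm_prod_add_left herm_prod_add_right herm_prod_scale_left
        herm_prod_scale_right cnj_herm_prod algebra_simps)
  also have "\<dots> = of_real ((cmod a)\<^sup>2 * (norm x)\<^sup>2 + (cmod b)\<^sup>2 * (norm y)\<^sup>2
      + 2 * Re (cnj a * b * herm_prod x y))"
    by (simp only: herm_prod_self cnj_mult_self complex_add_cnj of_real_add of_real_mult)
  finally show ?thesis
    unfolding herm_prod_self of_real_eq_iff .
qed

text \<open>The phases in \<open>w\<close> are adapted to \<open>v\<close>, so that both terms of
  \<open>herm_prod w v\<close> are nonnegative reals. Cauchy--Schwarz then applies, and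
  \<open>norm w\<close> has a bound independent of the phases.\<close>

lemma sum_cmod_herm_prod_le:
  fixes x y v :: "complex ^ 'n"
  assumes "0 \<le> a" "0 \<le> b"
  shows "a * cmod (herm_prod x v) + b * cmod (herm_prod y v) \<le>
    sqrt (a\<^sup>2 * (norm x)\<^sup>2 + b\<^sup>2 * (norm y)\<^sup>2 + 2 * a * b * cmod (herm_prod x y)) * norm v"
proof -
  define w where "w = (of_real a * cis (Arg (herm_prod x v))) *s x
    + (of_real b * cis (Arg (herm_prod y v))) *s y"
  have "herm_prod w v = of_real a * (cnj (cis (Arg (herm_prod x v))) * herm_prod x v)
      + of_real b * (cnj (cis (Arg (herm_prod y v))) * herm_prod y v)"
    by (simp add: w_def herm_prod_add_left herm_prod_scale_left)
  also have "\<dots> = of_real (a * cmod (herm_prod x v) + b * cmod (herm_prod y v))"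
    by (simp only: cnj_cis_Arg_mult of_real_add of_real_mult)
  finally have "a * cmod (herm_prod x v) + b * cmod (herm_prod y v) = cmod (herm_prod w v)"
    using assms by (simp del: of_real_add of_real_mult)
  also have "\<dots> \<le> norm w * norm v"
    by (rule cmod_herm_prod_le)
  also have "norm w \<le> sqrt (a\<^sup>2 * (norm x)\<^sup>2 + b\<^sup>2 * (norm y)\<^sup>2 + 2 * a * b * cmod (herm_prod x y))"
  proof (rule real_le_rsqrt)
    \<comment> \<open>The phases of \<open>w\<close> vary with \<open>v\<close>, so the cross term
      is estimated by its modulus for arbitrary \<open>p\<close> and \<open>q\<close>.\<close>
    have "Re (cnj (of_real a * cis p) * (of_real b * cis q) * herm_prod x y)
        \<le> a * b * cmod (herm_prod x y)" for p q
      by (rule order.trans[OF complex_Re_le_cmod]) (use assms in \<open>simp add: norm_mult\<close>)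
    then show "(norm w)\<^sup>2 \<le>
        a\<^sup>2 * (norm x)\<^sup>2 + b\<^sup>2 * (norm y)\<^sup>2 + 2 * a * b * cmod (herm_prod x y)"
      using assms unfolding w_def norm_lincomb_squared by (simp add: norm_mult mult.assoc)
  qed
  finally show ?thesis
    by (simp add: mult_right_mono)
qed

section \<open>Reformulation of (P1) in the single vector
  \<open>sqrt Pr *\<^sub>R vr\<close>\<close>

lemma P1_feasible_iff:
  fixes h :: "complex ^ 'm"
  assumes "h \<noteq> 0" "0 < Ps" "0 < sr2" "0 < \<eta>"
  defines "\<kappa> \<equiv> sqrt (\<eta> / (1 + 1 / (Ps * (norm h)\<^sup>2 / sr2)))"
  shows "P1_feasible Ps sr2 \<eta> h f (Pr, vr) \<longleftrightarrow> 0 \<le> Pr \<and> norm vr = 1 \<and>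
    norm (sqrt Pr *\<^sub>R vr) \<le>
      norm h * sqrt (\<eta> * Ps) + \<kappa> * cmod (herm_prod f (sqrt Pr *\<^sub>R vr))"
proof (cases "0 \<le> Pr \<and> norm vr = 1")
  case True
  define B where "B = norm h * sqrt (\<eta> * Ps)"
  define A where "A = recv_power Ps sr2 h"
  define t where "t = cmod (herm_prod f vr)"
  have nh: "0 < norm h" using assms by simp
  have A: "0 < A"
    using assms by (simp add: A_def recv_power_def add_nonneg_pos)
  \<comment> \<open>The received power is
    \<open>A = Ps * (norm h)\<^sup>2 * (1 + 1 / \<gamma>1)\<close>.\<close>
  have "\<eta> / (1 + 1 / (Ps * (norm h)\<^sup>2 / sr2)) = B\<^sup>2 / A"
    using assms nh A by (simp add: B_def A_def recv_power_def power_mult_distrib field_simps)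
  then have \<kappa>: "\<kappa> = B / sqrt A"
    using assms by (simp add: \<kappa>_def real_sqrt_divide B_def)
  have B: "0 \<le> B" using assms by (simp add: B_def)
  have "\<eta> * Ps * (norm h)\<^sup>2 * (1 + sqrt Pr / sqrt A * t)\<^sup>2 = (B + \<kappa> * (sqrt Pr * t))\<^sup>2"
  proof -
    have "\<eta> * Ps * (norm h)\<^sup>2 = B\<^sup>2"
      using assms by (simp add: B_def power_mult_distrib)
    moreover have "B + \<kappa> * (sqrt Pr * t) = B * (1 + sqrt Pr / sqrt A * t)"
      by (simp add: \<kappa> algebra_simps)
    ultimately show ?thesis by (simp add: power_mult_distrib)
  qed
  \<comment> \<open>The base of the square is nonnegative, so taking roots loses nothing.\<close>
  moreover have "Pr \<le> (B + \<kappa> * (sqrt Pr * t))\<^sup>2 \<longleftrightarrow> sqrt Pr \<le> B + \<kappa> * (sqrt Pr * t)"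
  proof -
    have "0 \<le> B + \<kappa> * (sqrt Pr * t)"
      using True B A by (simp add: \<kappa> t_def)
    then have "sqrt ((B + \<kappa> * (sqrt Pr * t))\<^sup>2) = B + \<kappa> * (sqrt Pr * t)"
      by simp
    then show ?thesis by (metis real_sqrt_le_iff)
  qed
  ultimately show ?thesis
    using True
    by (simp add: P1_feasible_def herm_prod_scaleR_right norm_mult flip: A_def B_def t_def)
qed (auto simp: P1_feasible_def)

lemma gamma2_eq:
  assumes "0 \<le> Pr"
  shows "gamma2 sd2 g (Pr, vr) = (cmod (herm_prod g (sqrt Pr *\<^sub>R vr)))\<^sup>2 / sd2"
  using assms by (simp add: gamma2_def herm_prod_scaleR_right norm_mult power_mult_distrib)

section \<open>Throughput as an increasing function of \<open>gamma2\<close>\<close>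

lemma gamma_d_eq:
  fixes h :: "complex ^ 'm"
  assumes "h \<noteq> 0" "0 < Ps" "0 < sr2" "0 < sd2" "0 \<le> fst x"
  defines "\<gamma>1 \<equiv> Ps * (norm h)\<^sup>2 / sr2"
  shows "gamma_d Ps sr2 sd2 h g x = \<gamma>1 * gamma2 sd2 g x / (\<gamma>1 + gamma2 sd2 g x + 1)"
proof -
  define P where "P = Ps * (norm h)\<^sup>2"
  define y where "y = fst x * (cmod (herm_prod g (snd x)))\<^sup>2"
  have P: "0 < P" and y: "0 \<le> y" using assms by (simp_all add: P_def y_def)
  \<comment> \<open>Only \<open>y \<noteq> 0\<close> needs computation: at \<open>y = 0\<close> the
    value \<open>0\<close> chosen in \<open>gamma_d\<close> agrees with the formula.\<close>
  have "P / (sr2 + sd2 * (P + sr2) / y) = P / sr2 * (y / sd2) / (P / sr2 + y / sd2 + 1)"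
    if "y \<noteq> 0"
  proof -
    have pos: "0 < sr2 * y + sd2 * (P + sr2)" using that P y assms by (simp add: add_pos_pos)
    have "sr2 + sd2 * (P + sr2) / y = (sr2 * y + sd2 * (P + sr2)) / y"
      using that by (simp add: field_simps)
    moreover have "P / sr2 + y / sd2 + 1 = (sr2 * y + sd2 * (P + sr2)) / (sr2 * sd2)"
      using assms by (simp add: field_simps)
    ultimately show ?thesis using pos assms by simp
  qed
  moreover have "gamma_d Ps sr2 sd2 h g x = (if y = 0 then 0 else P / (sr2 + sd2 * (P + sr2) / y))"
    by (simp add: gamma_d_def y_def P_def recv_power_def split_beta)
  moreover have "gamma2 sd2 g x = y / sd2" by (simp add: gamma2_def y_def split_beta)
  ultimately show ?thesis by (simp add: \<gamma>1_def flip: P_def)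
qed

text \<open>After cross-multiplication the two sides differ by
  \<open>a * (a + 1) * (t - s)\<close>.\<close>

lemma saturating_mono:
  fixes a s t :: real
  assumes "0 \<le> a" "0 \<le> s" "s \<le> t"
  shows "a * s / (a + s + 1) \<le> a * t / (a + t + 1)"
proof -
  have "a * s * (a + t + 1) \<le> a * t * (a + s + 1)"
    using mult_left_mono[OF mult_left_mono[OF assms(3), of "a + 1"] assms(1)] assms
    by (simp add: algebra_simps)
  then show ?thesis using assms by (simp add: divide_simps)
qed

lemma throughput_mono:
  fixes h :: "complex ^ 'm"
  assumes "h \<noteq> 0" "0 < Ps" "0 < sr2" "0 < sd2" "0 \<le> fst x" "0 \<le> fst y"
    and "gamma2 sd2 g x \<le> gamma2 sd2 g y"
  shows "throughput Ps sr2 sd2 h g x \<le> throughput Ps sr2 sd2 h g y"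
proof -
  have nn: "0 \<le> gamma2 sd2 g z" if "0 \<le> fst z" for z
    using that assms by (simp add: gamma2_def split_beta)
  have "gamma_d Ps sr2 sd2 h g x \<le> gamma_d Ps sr2 sd2 h g y"
    unfolding gamma_d_eq[OF assms(1-5)] gamma_d_eq[OF assms(1-4,6)]
    using assms nn[of x] by (intro saturating_mono) simp_all
  moreover have "0 \<le> gamma_d Ps sr2 sd2 h g x"
    using assms nn[of x] by (simp add: gamma_d_eq)
  ultimately show ?thesis by (simp add: throughput_def)
qed

section \<open>The reduced problem: maximise \<open>|g\<^sup>H v|\<close> subject to
  \<open>norm v \<le> B + k * |f\<^sup>H v|\<close>\<close>

context
  fixes f g :: "complex ^ 'n" and B k \<theta> d e :: real
  assumes nonzero: "f \<noteq> 0" "g \<noteq> 0" and B: "0 < B" and k: "0 < k" "k * norm f < 1"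
    and \<theta>: "0 \<le> \<theta>" "\<theta> \<le> pi / 2" "cos \<theta> = cmod (herm_prod f g) / (norm f * norm g)"
  defines "d \<equiv> sqrt (1 - k\<^sup>2 * (norm f)\<^sup>2 * (sin \<theta>)\<^sup>2)"
    and "e \<equiv> d - k * norm f * cos \<theta>"
begin

lemma cos_nonneg: "0 \<le> cos \<theta>"
  using \<theta>(3) by simp

lemma cmod_herm_prod_cos:
  "cmod (herm_prod f g) = norm f * norm g * cos \<theta>"
  "cmod (herm_prod g f) = norm f * norm g * cos \<theta>"
  using \<theta>(3) nonzero by (simp_all add: cmod_herm_prod_commute[of g f])

lemma kf_squared: "(k * norm f)\<^sup>2 < 1"
  using k nonzero by (simp add: power_less_one_iff abs_square_less_1)

lemma d_pos: "0 < d" and d_squared: "d\<^sup>2 = 1 - (k * norm f)\<^sup>2 * (sin \<theta>)\<^sup>2"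
proof -
  have "(k * norm f)\<^sup>2 * (sin \<theta>)\<^sup>2 \<le> (k * norm f)\<^sup>2 * 1"
    by (intro mult_left_mono) (simp_all add: abs_square_le_1)
  then have "0 < 1 - (k * norm f)\<^sup>2 * (sin \<theta>)\<^sup>2" using kf_squared by simp
  then show "0 < d" "d\<^sup>2 = 1 - (k * norm f)\<^sup>2 * (sin \<theta>)\<^sup>2"
    by (simp_all add: d_def power_mult_distrib)
qed

text \<open>A difference of squares. It links \<open>e\<close> to the denominators
  \<open>1 + 1 / \<gamma>1 - \<eta> * (norm f)\<^sup>2\<close> of the closed forms.\<close>

lemma conjugate_e: "e * (d + k * norm f * cos \<theta>) = 1 - (k * norm f)\<^sup>2"
proof -
  have "e * (d + k * norm f * cos \<theta>) = d\<^sup>2 - (k * norm f)\<^sup>2 * (cos \<theta>)\<^sup>2"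
    by (simp add: e_def power2_eq_square algebra_simps)
  also have "\<dots> = 1 - (k * norm f)\<^sup>2"
    unfolding d_squared cos_squared_eq by (simp add: algebra_simps)
  finally show ?thesis .
qed

lemma e_pos: "0 < e"
proof -
  have "0 < e * (d + k * norm f * cos \<theta>)" using kf_squared by (simp add: conjugate_e)
  moreover have "0 < d + k * norm f * cos \<theta>" using d_pos cos_nonneg k by (simp add: add_pos_nonneg)
  ultimately show ?thesis by (simp add: zero_less_mult_iff)
qed

text \<open>This says that \<open>e\<close> is the positive root of a quadratic: with aligned
  phases, the combination of \<open>g\<close> and \<open>f\<close> with weights
  \<open>e / norm g\<close> and \<open>k\<close> is a unit vector.\<close>

lemma certificate_norm: "e\<^sup>2 + k\<^sup>2 * (norm f)\<^sup>2 + 2 * e * k * norm f * cos \<theta> = 1"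
proof -
  have "e\<^sup>2 + k\<^sup>2 * (norm f)\<^sup>2 + 2 * e * k * norm f * cos \<theta>
      = e * (d + k * norm f * cos \<theta>) + (k * norm f)\<^sup>2"
    by (simp add: e_def power2_eq_square algebra_simps)
  then show ?thesis by (simp add: conjugate_e)
qed

text \<open>With these weights the term \<open>k * |f\<^sup>H v|\<close> appears on both sides and
  cancels, leaving a bound on \<open>|g\<^sup>H v|\<close> alone.\<close>

lemma herm_prod_bound:
  assumes "norm v \<le> B + k * cmod (herm_prod f v)"
  shows "cmod (herm_prod g v) \<le> B * norm g / e"
proof -
  have "(e / norm g)\<^sup>2 * (norm g)\<^sup>2 + k\<^sup>2 * (norm f)\<^sup>2
      + 2 * (e / norm g) * k * cmod (herm_prod g f) = 1"
    using certificate_norm nonzero by (simp add: cmod_herm_prod_cos power_divide mult_ac)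
  then have "e / norm g * cmod (herm_prod g v) + k * cmod (herm_prod f v) \<le> norm v"
    using sum_cmod_herm_prod_le[of "e / norm g" k g v f] e_pos k by simp
  with assms have "e / norm g * cmod (herm_prod g v) \<le> B" by linarith
  then show ?thesis using e_pos nonzero by (simp add: field_simps)
qed

text \<open>This \<open>v\<close> is the phase-aligned unit vector scaled by
  \<open>B / (e * d)\<close>. At scale \<open>s\<close> the constraint is tight when
  \<open>s * (1 - k * norm f * (e * cos \<theta> + k * norm f)) = B\<close>, and by
  \<open>certificate_norm\<close> the bracket equals
  \<open>e * (e + k * norm f * cos \<theta>) = e * d\<close>.\<close>

context
  fixes v :: "complex ^ 'n"
  defines "v \<equiv> (of_real (B / (norm g * d)) * cis (Arg (herm_prod g f))) *s g
    + of_real (k * B / (e * d)) *s f"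
begin

text \<open>Both contributions to \<open>herm_prod g v\<close> have the phase of
  \<open>herm_prod g f\<close>, so their moduli add up.\<close>

lemma herm_prod_g_optimal: "cmod (herm_prod g v) = B * norm g / e"
proof -
  have gf: "herm_prod g f = of_real (norm f * norm g * cos \<theta>) * cis (Arg (herm_prod g f))"
    using rcis_cmod_Arg[of "herm_prod g f"] by (simp add: rcis_def cmod_herm_prod_cos)
  have "herm_prod g v = of_real (B / (norm g * d)) * cis (Arg (herm_prod g f)) * of_real ((norm g)\<^sup>2)
      + of_real (k * B / (e * d)) * herm_prod g f"
    by (simp add: v_def herm_prod_add_right herm_prod_scale_right herm_prod_self)
  also have "\<dots> = of_real (B / (norm g * d) * (norm g)\<^sup>2 + k * B / (e * d) * (norm f * norm g * cos \<theta>))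
      * cis (Arg (herm_prod g f))"
    \<comment> \<open>Only the bare factor is put in polar form, not the occurrence inside
      \<open>Arg\<close>.\<close>
    by (subst (2) gf) (simp add: algebra_simps)
  also have "B / (norm g * d) * (norm g)\<^sup>2 + k * B / (e * d) * (norm f * norm g * cos \<theta>)
      = B * norm g * (e + k * norm f * cos \<theta>) / (e * d)"
    using e_pos d_pos nonzero by (simp add: field_simps power2_eq_square)
  also have "\<dots> = B * norm g / e"
    using d_pos by (simp add: e_def)
  finally show ?thesis
    using B e_pos by (simp add: norm_mult norm_divide)
qed

lemma norm_optimal: "norm v = B / (e * d)"
proof -
  have "cnj (cis (Arg (herm_prod g f))) * herm_prod g f = of_real (norm f * norm g * cos \<theta>)"
    by (simp only: cnj_cis_Arg_mult cmod_herm_prod_cos)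
  then have "cnj (of_real (B / (norm g * d)) * cis (Arg (herm_prod g f)))
      * of_real (k * B / (e * d)) * herm_prod g f
      = of_real (B / (norm g * d) * (k * B / (e * d)) * (norm f * norm g * cos \<theta>))"
    by (simp add: mult_ac)
  then have "(norm v)\<^sup>2 = (B / (norm g * d))\<^sup>2 * (norm g)\<^sup>2 + (k * B / (e * d))\<^sup>2 * (norm f)\<^sup>2
      + 2 * (B / (norm g * d) * (k * B / (e * d)) * (norm f * norm g * cos \<theta>))"
    unfolding v_def norm_lincomb_squared
    by (simp only: Re_complex_of_real norm_mult norm_cis norm_of_real power2_abs mult_1_right)
  \<comment> \<open>Taking out the scale leaves the squared norm of the unit vector.\<close>
  also have "\<dots> = (B / (e * d))\<^sup>2 * (e\<^sup>2 + k\<^sup>2 * (norm f)\<^sup>2 + 2 * e * k * norm f * cos \<theta>)"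
    using e_pos d_pos nonzero by (simp add: field_simps power2_eq_square)
  finally have "(norm v)\<^sup>2 = (B / (e * d))\<^sup>2" by (simp add: certificate_norm)
  then show ?thesis using B e_pos d_pos by (simp add: power2_eq_iff_nonneg)
qed

text \<open>The phase of \<open>g\<close> in \<open>v\<close> cancels that of
  \<open>herm_prod f g\<close>, the conjugate of \<open>herm_prod g f\<close>, so
  \<open>herm_prod f v\<close> is a nonnegative real.\<close>

lemma optimal_tight: "norm v = B + k * cmod (herm_prod f v)"
proof -
  have fg: "cis (Arg (herm_prod g f)) * herm_prod f g = of_real (norm f * norm g * cos \<theta>)"
    using arg_cong[OF cnj_cis_Arg_mult[of "herm_prod g f"], of cnj]
    by (simp add: cnj_herm_prod cmod_herm_prod_cos)
  have "herm_prod f v = of_real (B / (norm g * d)) * (cis (Arg (herm_prod g f)) * herm_prod f g)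
      + of_real (k * B / (e * d)) * of_real ((norm f)\<^sup>2)"
    by (simp add: v_def herm_prod_add_right herm_prod_scale_right herm_prod_self)
  also have "\<dots> = of_real (B / (norm g * d) * (norm f * norm g * cos \<theta>)
      + k * B / (e * d) * (norm f)\<^sup>2)"
    by (simp only: fg of_real_add of_real_mult)
  finally have "cmod (herm_prod f v)
      = B / (norm g * d) * (norm f * norm g * cos \<theta>) + k * B / (e * d) * (norm f)\<^sup>2"
    using B k e_pos d_pos cos_nonneg by (simp only: norm_of_real) simp
  \<comment> \<open>By \<open>conjugate_e\<close> the bracket on the right is
    \<open>1\<close>.\<close>
  moreover have "B + k * (B / (norm g * d) * (norm f * norm g * cos \<theta>)
        + k * B / (e * d) * (norm f)\<^sup>2)
      = B * (e * (d + k * norm f * cos \<theta>) + (k * norm f)\<^sup>2) / (e * d)"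
    using e_pos d_pos nonzero by (simp add: field_simps power2_eq_square)
  ultimately show ?thesis by (simp add: norm_optimal conjugate_e)
qed

end

end

section \<open>Translation back to the parameters of (P1)\<close>

theorem theorem1:
  fixes h :: "complex ^ 'm" and f g v_star vr_star :: "complex ^ 'n"
    and Ps sr2 sd2 \<eta> \<gamma>1 \<theta> \<alpha>1 \<alpha>2 Pr_star \<gamma>2_star R_star :: real
  assumes "h \<noteq> 0" and "f \<noteq> 0" and "g \<noteq> 0"
    and "Ps > 0" and "sr2 > 0" and "sd2 > 0"
    and "0 < \<eta>" and "\<eta> \<le> 1"
    and "\<gamma>1 = Ps * (norm h)\<^sup>2 / sr2"
    and "0 \<le> \<theta>" and "\<theta> \<le> pi / 2"
    and "cos \<theta> = cmod (herm_prod f g) / (norm f * norm g)"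
    and "\<eta> * (norm f)\<^sup>2 < 1 + 1 / \<gamma>1"
    and "\<alpha>1 = norm h * sqrt ((1 + 1 / \<gamma>1) * \<eta> * Ps) /
      (norm g * sqrt (1 + 1 / \<gamma>1 - \<eta> * (norm f)\<^sup>2 * (sin \<theta>)\<^sup>2))"
    and "\<alpha>2 = \<eta> * norm h * sqrt ((1 + 1 / \<gamma>1) * Ps) / (1 + 1 / \<gamma>1 - \<eta> * (norm f)\<^sup>2) *
      (1 + sqrt \<eta> * norm f * cos \<theta> / sqrt (1 + 1 / \<gamma>1 - \<eta> * (norm f)\<^sup>2 * (sin \<theta>)\<^sup>2))"
    and "v_star = (complex_of_real \<alpha>1 * exp (\<i> * complex_of_real (Arg (herm_prod g f)))) *s g
      + complex_of_real \<alpha>2 *s f"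
    and "Pr_star = (norm v_star)\<^sup>2"
    and "vr_star = (1 / norm v_star) *\<^sub>R v_star"
    and "\<gamma>2_star = (1 + 1 / \<gamma>1) * \<eta> * Ps * (norm h)\<^sup>2 * (norm g)\<^sup>2 /
        (sd2 * (1 + 1 / \<gamma>1 - \<eta> * (norm f)\<^sup>2)\<^sup>2) *
      (sqrt \<eta> * norm f * cos \<theta> + sqrt (1 + 1 / \<gamma>1 - \<eta> * (norm f)\<^sup>2 * (sin \<theta>)\<^sup>2))\<^sup>2"
    and "R_star = 1 / 2 * log 2 (1 + \<gamma>1 * \<gamma>2_star / (\<gamma>1 + \<gamma>2_star + 1))"
  shows "is_arg_max (gamma2 sd2 g) (P1_feasible Ps sr2 \<eta> h f) (Pr_star, vr_star)
    \<and> gamma2 sd2 g (Pr_star, vr_star) = \<gamma>2_star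
    \<and> (\<exists>x. is_arg_max (throughput Ps sr2 sd2 h g) (P1_feasible Ps sr2 \<eta> h f) x
          \<and> throughput Ps sr2 sd2 h g x = R_star)"
proof -
  define K where "K = 1 + 1 / \<gamma>1"
  define B where "B = norm h * sqrt (\<eta> * Ps)"
  define k where "k = sqrt (\<eta> / K)"
  define d where "d = sqrt (1 - k\<^sup>2 * (norm f)\<^sup>2 * (sin \<theta>)\<^sup>2)"
  define e where "e = d - k * norm f * cos \<theta>"
  have \<gamma>1: "0 < \<gamma>1" using assms(1,4,5,9) by simp
  then have K: "1 < K" by (simp add: K_def)
  have B: "0 < B" using assms(1,4,7) by (simp add: B_def)
  have k: "0 < k" using assms(7) K by (simp add: k_def)
  have k2: "k\<^sup>2 = \<eta> / K" using assms(7) K by (simp add: k_def)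
  \<comment> \<open>The hypothesis on \<open>\<eta> * (norm f)\<^sup>2\<close>, divided by
    \<open>K\<close>. It bounds the feasible vectors, since
    \<open>norm v \<le> B + k * norm f * norm v\<close> then limits \<open>norm v\<close>.\<close>
  have "(k * norm f)\<^sup>2 < 1"
    using assms(13) K unfolding K_def[symmetric] power_mult_distrib k2 by (simp add: field_simps)
  then have kf: "k * norm f < 1" using k by (simp add: power2_less_imp_less)
  note ctx = assms(2,3) B k kf assms(10-12)
  note d_pos = d_pos[OF ctx, folded d_def]
  note e_pos = e_pos[OF ctx, folded d_def, folded e_def]
  note conjugate_e = conjugate_e[OF ctx, folded d_def, folded e_def]

  \<comment> \<open>The next three identities extract powers of \<open>sqrt K\<close>, which cancel
    in the closed forms.\<close>
  have sqrt_eta: "sqrt \<eta> = sqrt K * k"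
    using K by (simp add: k_def flip: real_sqrt_mult)
  have sqrt_d: "sqrt (K - \<eta> * (norm f)\<^sup>2 * (sin \<theta>)\<^sup>2) = sqrt K * d"
    unfolding d_def k2 real_sqrt_mult[symmetric] using K by (simp add: algebra_simps)
  have K_minus: "K - \<eta> * (norm f)\<^sup>2 = K * (e * (d + k * norm f * cos \<theta>))"
    unfolding conjugate_e power_mult_distrib k2 using K by (simp add: algebra_simps)
  have sK: "0 < sqrt K" "sqrt K * sqrt K = K" using K by simp_all
  have pos: "0 < d + k * norm f * cos \<theta>"
    using d_pos k assms(12) by (simp add: add_pos_nonneg)
  have \<alpha>1: "\<alpha>1 = B / (norm g * d)"
    unfolding assms(14) K_def[symmetric] sqrt_d B_def
    using sK(1) by (simp add: real_sqrt_mult)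
  have \<alpha>2: "\<alpha>2 = k * B / (e * d)"
  proof -
    have "\<eta> = sqrt K * k * sqrt \<eta>"
      using assms(7) by (simp flip: sqrt_eta)
    then have "\<eta> * norm h * sqrt (K * Ps) = sqrt K * k * sqrt \<eta> * norm h * sqrt (K * Ps)"
      by (rule arg_cong)
    also have "\<dots> = sqrt K * sqrt K * (k * B)"
      by (simp only: real_sqrt_mult B_def mult_ac)
    finally have num: "\<eta> * norm h * sqrt (K * Ps) = K * (k * B)"
      by (simp only: sK(2))
    have "\<alpha>2 = K * (k * B) / (K * (e * (d + k * norm f * cos \<theta>)))
        * (1 + sqrt K * k * norm f * cos \<theta> / (sqrt K * d))"
      unfolding assms(15) K_def[symmetric] sqrt_d K_minus num sqrt_eta ..
    \<comment> \<open>The last factor cancels the conjugate of \<open>e\<close> in the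
      denominator.\<close>
    also have "\<dots> = k * B / (e * (d + k * norm f * cos \<theta>)) * ((d + k * norm f * cos \<theta>) / d)"
      using K sK(1) d_pos by (simp add: add_divide_distrib)
    finally show ?thesis using pos by simp
  qed
  have v_star: "v_star = (of_real (B / (norm g * d)) * cis (Arg (herm_prod g f))) *s g
      + of_real (k * B / (e * d)) *s f"
    unfolding assms(16) \<alpha>1 \<alpha>2 cis_conv_exp ..
  have \<gamma>2: "\<gamma>2_star = (B * norm g / e)\<^sup>2 / sd2"
  proof -
    have "\<gamma>2_star = K * B\<^sup>2 * (norm g)\<^sup>2 / (sd2 * (K * (e * (d + k * norm f * cos \<theta>)))\<^sup>2)
        * (sqrt K * (d + k * norm f * cos \<theta>))\<^sup>2"
      unfolding assms(19) K_def[symmetric] sqrt_d K_minus sqrt_eta B_def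
      using assms(4,7) by (simp add: power_mult_distrib algebra_simps)
    \<comment> \<open>The squared conjugate of \<open>e\<close> cancels here, so only
      \<open>e\<close> remains.\<close>
    also have "\<dots> = K * B\<^sup>2 * (norm g)\<^sup>2 * K / (sd2 * K\<^sup>2 * e\<^sup>2)"
      using K pos by (simp add: power_mult_distrib)
    finally show ?thesis
      using K by (simp add: power_divide power_mult_distrib power2_eq_square mult_ac)
  qed

  have norm_v: "norm v_star = B / (e * d)"
    unfolding v_star by (rule norm_optimal[OF ctx, folded d_def, folded e_def])
  then have norm_v_pos: "0 < norm v_star" using B e_pos d_pos by simp
  \<comment> \<open>As \<open>v_star\<close> is nonzero, the normalisation is undone
    exactly.\<close>
  then have v_eq: "sqrt Pr_star *\<^sub>R vr_star = v_star"
    unfolding assms(17,18) by simp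
  have gv: "cmod (herm_prod g v_star) = B * norm g / e"
    unfolding v_star by (rule herm_prod_g_optimal[OF ctx, folded d_def, folded e_def])
  have tight: "norm v_star = B + k * cmod (herm_prod f v_star)"
    unfolding v_star by (rule optimal_tight[OF ctx, folded d_def, folded e_def])
  note feasible_iff = P1_feasible_iff[OF assms(1,4,5,7), folded assms(9), folded K_def,
      folded k_def B_def]
  have Pr_nonneg: "0 \<le> Pr_star" by (simp add: assms(17))
  have feasible: "P1_feasible Ps sr2 \<eta> h f (Pr_star, vr_star)"
    unfolding feasible_iff v_eq using tight norm_v_pos Pr_nonneg by (simp add: assms(18))
  have attained: "gamma2 sd2 g (Pr_star, vr_star) = \<gamma>2_star"
    using Pr_nonneg by (simp add: gamma2_eq v_eq gv \<gamma>2)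
  have bound: "gamma2 sd2 g x \<le> \<gamma>2_star" if "P1_feasible Ps sr2 \<eta> h f x" for x
  proof (cases x)
    case (Pair Pr vr)
    with that have "0 \<le> Pr"
      and "norm (sqrt Pr *\<^sub>R vr) \<le> B + k * cmod (herm_prod f (sqrt Pr *\<^sub>R vr))"
      by (simp_all only: feasible_iff)
    moreover from herm_prod_bound[OF ctx this(2), folded d_def, folded e_def]
    have "(cmod (herm_prod g (sqrt Pr *\<^sub>R vr)))\<^sup>2 \<le> (B * norm g / e)\<^sup>2"
      by (rule power_mono) simp
    ultimately show ?thesis
      unfolding Pair \<gamma>2 using assms(6) by (simp only: gamma2_eq divide_right_mono less_imp_le)
  qed
  \<comment> \<open>By monotonicity, the maximiser of \<open>gamma2\<close> also serves as witness
    for the throughput.\<close>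
  have "throughput Ps sr2 sd2 h g x \<le> throughput Ps sr2 sd2 h g (Pr_star, vr_star)"
    if "P1_feasible Ps sr2 \<eta> h f x" for x
    using that bound[OF that] Pr_nonneg
    by (intro throughput_mono assms) (auto simp: attained P1_feasible_def)
  moreover have "throughput Ps sr2 sd2 h g (Pr_star, vr_star) = R_star"
    using Pr_nonneg gamma_d_eq[OF assms(1,4,5,6), of "(Pr_star, vr_star)" g]
    by (simp add: throughput_def attained assms(20) flip: assms(9))
  ultimately show ?thesis
    using feasible bound attained by (force simp: is_arg_max_def not_less)
qed

end
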